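(* Let $a,b\ge0$, let $f\in C^1(\mathbb R)$ be Lipschitz with constant $\mathrm{Lip}(f)$, and let $\mathcal G_h,\mathcal L_h\in\mathbb R^{N_x^2\times N_x^2}$ be self-adjoint, non-negative definite and commuting, $\mathcal G_h\mathcal L_h=\mathcal L_h\mathcal G_h$. Let $h_t>0$ satisfy $h_t\,|b|\,\|\mathcal G_h\|\,\mathrm{Lip}(f)<1$. With $\widehat F$ the preconditioned map of the time-implicit scheme defined in the context, let $$\underline\sigma=\inf_{U}\sigma_{\min}(D\widehat F(U)),\qquad\overline\sigma=\sup_{U}\sigma_{\max}(D\widehat F(U)),\qquad\kappa=\overline\sigma/\underline\sigma .$$ (Under these hypotheses $0<\underline\sigma\le\overline\sigma<\infty$.) Let $\gamma=\frac{1-\delta}{\kappa}$ and $\epsilon=(1-\delta)\kappa$ with $|\delta|<\frac1\kappa$, and let $(U_t,Q_t)_{t\ge0}$ be a solution, with arbitrary initial condition, of the PDHG flow $$\dot Q=-\epsilon Q+\widehat F(U),\qquad\dot U=-D\widehat F(U)^\top\big((1-\gamma\epsilon)Q+\gamma\widehat F(U)\big).$$ Then $\|\widehat F(U_t)\|$ converges exponentially fast to $0$, i.e. there are constants $C\ge0$, $r>0$ with $\|\widehat F(U_t)\|\le Ce^{-rt}$ for all $t\ge0$.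
   Context: Let $N_t,N_x$ be positive integers, $n=N_x^2$, $h_t>0$, $T=N_th_t$. Define $F:\mathbb R^{N_tn}\to\mathbb R^{N_tn}$ by $$F(U)=\mathscr DU+h_t\mathscr G_h(a\mathscr L_hU+bf(U))-V,$$ where $f$ acts entrywise, $\mathscr D=D_{N_t}\otimes I_n$ with $D_{N_t}$ the $N_t\times N_t$ matrix having $1$ on the diagonal, $-1$ on the first subdiagonal and $0$ elsewhere, $\mathscr G_h=I_{N_t}\otimes\mathcal G_h$, $\mathscr L_h=I_{N_t}\otimes\mathcal L_h$, and $V\in\mathbb R^{N_tn}$ is a constant vector. $J_f$ is a fixed $n\times n$ matrix such that $$\mathscr M=\mathscr D+ah_t\mathscr G_h\mathscr L_h+bh_t\mathscr G_h(I_{N_t}\otimes J_f)$$ is invertible, and $\widehat F(U)=\mathscr M^{-1}F(U)$. $\|\cdot\|$ is the Euclidean norm for vectors and the spectral norm for matrices; $\sigma_{\min},\sigma_{\max}$ are the smallest and largest singular values. The infimum and supremum are over $U\in\mathbb R^{N_tn}$. *)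

theory Defs
  imports "HOL-Analysis.Analysis"
begin

definition kronecker ::
  "real^'n^'m \<Rightarrow> real^'q^'p \<Rightarrow> real^('n \<times> 'q)^('m \<times> 'p)" where
  "kronecker A B = (\<chi> i j. A $ fst i $ fst j * B $ snd i $ snd j)"

(* The time levels are the elements of a finite linearly ordered type. "First subdiagonal"
   means that the row index is the immediate successor of the column index. *)
definition backward_diff :: "real^('t::{finite,linorder})^('t::{finite,linorder})" where
  "backward_diff =
     (\<chi> i j. if i = j then 1 else if j < i \<and> {j<..<i} = {} then -1 else 0)"

definition nonneg_definite :: "real^'n^'n \<Rightarrow> bool" where
  "nonneg_definite A \<longleftrightarrow> (\<forall>x. 0 \<le> x \<bullet> (A *v x))"

definition singular_values :: "real^'n^'n \<Rightarrow> real set" where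
  "singular_values A =
     sqrt ` {l. \<exists>v. v \<noteq> 0 \<and> (transpose A ** A) *v v = l *\<^sub>R v}"

definition sigma_min :: "real^'n^'n \<Rightarrow> real" where
  "sigma_min A = Min (singular_values A)"

definition sigma_max :: "real^'n^'n \<Rightarrow> real" where
  "sigma_max A = Max (singular_values A)"

definition scheme_residual ::
  "real \<Rightarrow> real \<Rightarrow> real \<Rightarrow> (real \<Rightarrow> real) \<Rightarrow> real^'s^'s \<Rightarrow> real^'s^'s
    \<Rightarrow> real^('t::{finite,linorder} \<times> 's) \<Rightarrow> real^('t \<times> 's) \<Rightarrow> real^('t \<times> 's)" where
  "scheme_residual a b h f G L V U =
     kronecker backward_diff (mat 1) *v U
     + h *\<^sub>R (kronecker (mat 1) G *v
         (a *\<^sub>R (kronecker (mat 1) L *v U) + b *\<^sub>R (\<chi> i. f (U $ i))))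
     - V"

definition preconditioner ::
  "real \<Rightarrow> real \<Rightarrow> real \<Rightarrow> real^'s^'s \<Rightarrow> real^'s^'s \<Rightarrow> real^'s^'s
    \<Rightarrow> real^('t::{finite,linorder} \<times> 's)^('t \<times> 's)" where
  "preconditioner a b h G L J =
     kronecker backward_diff (mat 1)
     + (a * h) *\<^sub>R (kronecker (mat 1) G ** kronecker (mat 1) L)
     + (b * h) *\<^sub>R (kronecker (mat 1) G ** kronecker (mat 1) J)"

definition preconditioned_residual ::
  "real \<Rightarrow> real \<Rightarrow> real \<Rightarrow> (real \<Rightarrow> real) \<Rightarrow> real^'s^'s \<Rightarrow> real^'s^'s \<Rightarrow> real^'s^'s
    \<Rightarrow> real^('t::{finite,linorder} \<times> 's) \<Rightarrow> real^('t \<times> 's) \<Rightarrow> real^('t \<times> 's)" where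
  "preconditioned_residual a b h f G L J V U =
     matrix_inv (preconditioner a b h G L J) *v scheme_residual a b h f G L V U"

definition pdhg_flow ::
  "(real^'n \<Rightarrow> real^'n) \<Rightarrow> real \<Rightarrow> real \<Rightarrow> (real \<Rightarrow> real^'n) \<Rightarrow> (real \<Rightarrow> real^'n) \<Rightarrow> bool" where
  "pdhg_flow F \<gamma> \<epsilon> U Q \<longleftrightarrow>
     (\<forall>t\<ge>0.
        (Q has_vector_derivative - (\<epsilon> *\<^sub>R Q t) + F (U t)) (at t within {0..}) \<and>
        (U has_vector_derivative
           - (transpose (jacobian F (at (U t))) *v
                ((1 - \<gamma> * \<epsilon>) *\<^sub>R Q t + \<gamma> *\<^sub>R F (U t)))) (at t within {0..}))"

end

theory Submission imports Defs begin

text \<open>Slicing the linearized scheme by time levels gives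
  \<open>(I + a h G L) v\<^sub>k = y\<^sub>k + v\<^sub>k\<^sub>-\<^sub>1 - b h G w\<^sub>k\<close> with \<open>norm w\<^sub>k \<le> Lip(f) * norm v\<^sub>k\<close>. As \<open>G\<close> and \<open>L\<close>
  commute, \<open>G L\<close> is non-negative, so the left-hand side is at least as long as \<open>v\<^sub>k\<close>, and smallness of
  \<open>h\<close> absorbs the last term. Induction over the levels bounds \<open>v\<close> by \<open>y\<close> uniformly in the base point,
  whence the bounds on the singular values.

  For the flow, let \<open>T = D D\<^sup>T / \<sigma>\<^sub>l\<^sub>o\<^sup>2\<close> with \<open>D\<close> the derivative of the preconditioned residual \<open>F\<close>, so
  that \<open>1 \<le> T \<le> \<kappa>\<^sup>2\<close>. The energy \<open>norm F ^ 2 / \<sigma>\<^sub>l\<^sub>o\<^sup>2 + norm Q ^ 2\<close> decreases at the rate given by twice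
  a quadratic form in \<open>(F, Q)\<close> with coefficients polynomial in \<open>T\<close>, whose discriminant has a fixed sign
  on \<open>{1..\<kappa>\<^sup>2}\<close> because \<open>\<bar>\<delta>\<bar> < 1 / \<kappa>\<close>. Hence the energy decays exponentially.\<close>

section \<open>Eigenvalues of self-adjoint maps\<close>

text \<open>This is the first-order condition for a minimum at \<open>t = 0\<close>. It serves to
  show that a minimizer of a Rayleigh quotient is an eigenvector.\<close>

lemma quadratic_nonneg_imp_linear_zero:
  fixes p c :: real
  assumes "\<And>t. 0 \<le> 2 * t * p + t\<^sup>2 * c"
  shows "p = 0"
proof (rule ccontr)
  assume "p \<noteq> 0"
  \<comment> \<open>At \<open>t = - p / d\<close> the quadratic equals
    \<open>p\<^sup>2 / d\<^sup>2 * (c - 2 * d)\<close>, so any positive \<open>d > c / 2\<close>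
    gives a contradiction. The summand 1 keeps \<open>d\<close> positive when
    \<open>c = 0\<close>.\<close>
  define d where "d = \<bar>c\<bar> + 1"
  have d: "d > 0" "c - 2 * d < 0" by (auto simp: d_def)
  have "0 \<le> 2 * (- p / d) * p + (- p / d)\<^sup>2 * c"
    by (rule assms)
  also have "\<dots> = (p\<^sup>2 / d\<^sup>2) * (c - 2 * d)"
    using d by (simp add: field_simps power2_eq_square)
  also have "\<dots> < 0"
    using d \<open>p \<noteq> 0\<close> by (intro mult_pos_neg) auto
  finally show False by simp
qed

text \<open>The eigenvector minimizes the Rayleigh quotient over the compact unit sphere of
  \<open>E\<close>. Allowing an invariant subspace \<open>E\<close> makes it possible to find an
  eigenvector of one map inside an eigenspace of another.\<close>

lemma self_adjoint_min_eigenvector: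
  fixes f :: "'a::euclidean_space \<Rightarrow> 'a"
  assumes lin: "linear f" and sub: "subspace E"
    and inv: "\<And>x. x \<in> E \<Longrightarrow> f x \<in> E"
    and adj: "\<And>x y. f x \<bullet> y = x \<bullet> f y"
    and ne: "w \<in> E" "w \<noteq> 0"
  obtains v l where "v \<in> E" "norm v = 1" "f v = l *\<^sub>R v"
    "\<And>x. x \<in> E \<Longrightarrow> l * (x \<bullet> x) \<le> x \<bullet> f x"
proof -
  interpret f: linear f by (rule lin)
  let ?K = "E \<inter> sphere 0 1"
  have "compact ?K"
    by (simp add: closed_Int_compact closed_subspace sub)
  moreover have "w /\<^sub>R norm w \<in> ?K"
    using ne sub by (auto intro: subspace_scale)
  then have "?K \<noteq> {}" by blast
  moreover have "continuous_on ?K (\<lambda>x. x \<bullet> f x)"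
    using lin by (intro continuous_on_inner continuous_on_id linear_continuous_on)
      (simp add: linear_conv_bounded_linear)
  ultimately have "\<exists>v\<in>?K. \<forall>y\<in>?K. v \<bullet> f v \<le> y \<bullet> f y"
    by (rule continuous_attains_inf)
  then obtain v where v: "v \<in> ?K" and min: "\<And>y. y \<in> ?K \<Longrightarrow> v \<bullet> f v \<le> y \<bullet> f y"
    by metis
  define l where "l = v \<bullet> f v"
  have vE: "v \<in> E" and nv: "norm v = 1" using v by auto
  have vv: "v \<bullet> v = 1" using nv by (simp add: norm_eq_1)
  have ray: "l * (x \<bullet> x) \<le> x \<bullet> f x" if "x \<in> E" for x
  proof (cases "x = 0")
    case False
    have "x /\<^sub>R norm x \<in> ?K"
      using that False sub by (auto intro: subspace_scale)
    from min[OF this] have "l \<le> (inverse (norm x))\<^sup>2 * (x \<bullet> f x)"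
      by (simp add: l_def f.scaleR power2_eq_square mult.assoc)
    then have "l * (norm x)\<^sup>2 \<le> (inverse (norm x))\<^sup>2 * (x \<bullet> f x) * (norm x)\<^sup>2"
      by (intro mult_right_mono) auto
    also have "\<dots> = x \<bullet> f x" using False by (simp add: power_inverse)
    finally show ?thesis by (simp add: power2_norm_eq_inner)
  qed simp
  define u where "u = f v - l *\<^sub>R v"
  have uE: "u \<in> E"
    unfolding u_def using sub vE inv by (intro subspace_diff subspace_scale)
  \<comment> \<open>Perturb \<open>v\<close> in the direction of its residual \<open>u\<close>,
    which lies in \<open>E\<close> by invariance. By \<open>ray\<close> the result is a nonnegative
    quadratic in \<open>t\<close>; its constant term vanishes by the choice of \<open>l\<close>, and
    its linear coefficient is \<open>2 * (u \<bullet> u)\<close>.\<close>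
  have "u \<bullet> u = 0"
  proof (rule quadratic_nonneg_imp_linear_zero)
    fix t :: real
    have "v + t *\<^sub>R u \<in> E"
      using sub vE uE by (intro subspace_add subspace_scale)
    from ray[OF this]
    have "0 \<le> (v + t *\<^sub>R u) \<bullet> f (v + t *\<^sub>R u) - l * ((v + t *\<^sub>R u) \<bullet> (v + t *\<^sub>R u))"
      by simp
    also have "\<dots> = (v \<bullet> f v - l * (v \<bullet> v)) + t * (u \<bullet> f v + v \<bullet> f u - 2 * (l * (u \<bullet> v)))
        + t\<^sup>2 * (u \<bullet> f u - l * (u \<bullet> u))"
      by (simp add: f.add f.scaleR inner_left_distrib inner_right_distrib inner_commute[of v u]
          algebra_simps power2_eq_square)
    also have "\<dots> = 2 * t * (u \<bullet> f v - l * (u \<bullet> v)) + t\<^sup>2 * (u \<bullet> f u - l * (u \<bullet> u))"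
    proof -
      have "v \<bullet> f u = u \<bullet> f v" using adj[of v u] by (simp add: inner_commute)
      moreover have "v \<bullet> f v - l * (v \<bullet> v) = 0" by (simp add: vv l_def)
      ultimately show ?thesis by (simp add: algebra_simps)
    qed
    also have "u \<bullet> f v - l * (u \<bullet> v) = u \<bullet> (f v - l *\<^sub>R v)"
      by (simp add: inner_diff_right)
    also have "\<dots> = u \<bullet> u" by (simp only: u_def)
    finally show "0 \<le> 2 * t * (u \<bullet> u) + t\<^sup>2 * (u \<bullet> f u - l * (u \<bullet> u))" .
  qed
  then have "f v = l *\<^sub>R v" by (simp add: u_def)
  with vE nv ray that show thesis by blast
qed

text \<open>If the smallest eigenvalue of the product were negative, the first factor would have an
  eigenvector in the corresponding eigenspace, on which the second factor is then negative.\<close>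

lemma commuting_nonneg_product:
  fixes f g :: "'a::euclidean_space \<Rightarrow> 'a"
  assumes f: "linear f" "\<And>x y. f x \<bullet> y = x \<bullet> f y" "\<And>x. 0 \<le> x \<bullet> f x"
    and g: "linear g" "\<And>x y. g x \<bullet> y = x \<bullet> g y" "\<And>x. 0 \<le> x \<bullet> g x"
    and comm: "\<And>x. f (g x) = g (f x)"
  shows "0 \<le> x \<bullet> f (g x)"
proof (cases "x = 0")
  case False
  have lin: "linear (\<lambda>x. f (g x))"
    using linear_compose[OF g(1) f(1)] by (simp add: o_def)
  obtain v l where v: "norm v = 1" "f (g v) = l *\<^sub>R v"
    and ray: "\<And>x. l * (x \<bullet> x) \<le> x \<bullet> f (g x)"
    using self_adjoint_min_eigenvector[OF lin subspace_UNIV _ _ _ False]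
    by (metis UNIV_I comm f(2) g(2))
  \<comment> \<open>The eigenspace is invariant under \<open>f\<close> because
    \<open>f (g (f y)) = f (f (g y)) = l *\<^sub>R f y\<close>.\<close>
  define E where "E = {y. f (g y) = l *\<^sub>R y}"
  have "subspace E"
    unfolding E_def by (rule subspaceI)
      (auto simp: linear_0[OF lin] linear_add[OF lin] linear_scale[OF lin] scaleR_add_right)
  moreover have "f y \<in> E" if "y \<in> E" for y
    using that by (metis (mono_tags, lifting) E_def comm f(1) linear_scale mem_Collect_eq)
  moreover have "v \<in> E" "v \<noteq> 0" using v by (auto simp: E_def)
  ultimately obtain w k where w: "w \<in> E" "norm w = 1" "f w = k *\<^sub>R w"
    using self_adjoint_min_eigenvector[OF f(1), of E v] f(2) by metis
  have ww: "w \<bullet> w = 1" using w by (simp add: norm_eq_1)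
  have "k \<ge> 0" using f(3)[of w] w ww by simp
  have "l *\<^sub>R w = k *\<^sub>R g w"
    using w(1) comm[of w] by (simp add: E_def w(3) linear_scale[OF g(1)])
  then have "l = k * (w \<bullet> g w)"
    using ww by (metis inner_scaleR_right mult.right_neutral)
  then have "0 \<le> l" using \<open>k \<ge> 0\<close> g(3) by simp
  then show ?thesis
    using ray[of x] by (smt (verit) inner_ge_zero mult_nonneg_nonneg)
qed (simp add: linear_0[OF f(1)] linear_0[OF g(1)])

text \<open>Eigenvectors for distinct eigenvalues are orthogonal, hence independent, and an
  independent set is finite. Without finiteness the \<open>Min\<close> and \<open>Max\<close> in
  \<open>sigma_min\<close> and \<open>sigma_max\<close> would carry no information.\<close>

lemma finite_self_adjoint_eigenvalues:
  fixes f :: "'a::euclidean_space \<Rightarrow> 'a"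
  assumes adj: "\<And>x y. f x \<bullet> y = x \<bullet> f y"
  shows "finite {l. \<exists>v. v \<noteq> 0 \<and> f v = l *\<^sub>R v}" (is "finite ?S")
proof -
  define S where "S = ?S"
  have "\<exists>e. \<forall>l\<in>S. e l \<noteq> 0 \<and> f (e l) = l *\<^sub>R e l"
    by (rule bchoice) (simp add: S_def)
  then obtain e where e: "\<And>l. l \<in> S \<Longrightarrow> e l \<noteq> 0" "\<And>l. l \<in> S \<Longrightarrow> f (e l) = l *\<^sub>R e l"
    by blast
  have orth: "e l \<bullet> e k = 0" if "l \<in> S" "k \<in> S" "l \<noteq> k" for l k
    using adj[of "e l" "e k"] e(2)[OF that(1)] e(2)[OF that(2)] that(3) by simp
  have inj: "inj_on e S"
    by (rule inj_onI) (metis e(1) inner_eq_zero_iff orth)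
  have "pairwise orthogonal (e ` S)"
    unfolding pairwise_def orthogonal_def using orth by blast
  moreover have "0 \<notin> e ` S" using e(1) by force
  ultimately have "independent (e ` S)"
    by (rule pairwise_orthogonal_independent)
  then have "finite (e ` S)" by (rule independent_imp_finite)
  then show ?thesis using inj finite_imageD unfolding S_def by blast
qed

section \<open>Singular values\<close>

lemma inner_matrix_transpose:
  fixes A :: "real^'n^'m"
  shows "(A *v x) \<bullet> y = x \<bullet> (transpose A *v y)"
  by (metis dot_lmul_matrix inner_commute vector_transpose_matrix)

lemma gram_inner:
  fixes A :: "real^'n^'n"
  shows "x \<bullet> ((transpose A ** A) *v y) = (A *v x) \<bullet> (A *v y)"
  by (simp add: inner_matrix_transpose matrix_vector_mul_assoc)

lemma gram_self_adjoint:
  fixes A :: "real^'n^'n"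
  shows "((transpose A ** A) *v x) \<bullet> y = x \<bullet> ((transpose A ** A) *v y)"
  by (simp add: inner_matrix_transpose matrix_transpose_mul)

lemma gram_eigenvalue:
  fixes A :: "real^'n^'n"
  assumes "(transpose A ** A) *v v = l *\<^sub>R v"
  shows "(norm (A *v v))\<^sup>2 = l * (norm v)\<^sup>2"
  using gram_inner[of v A v] assms by (simp add: power2_norm_eq_inner)

lemma singular_value_imp_norm:
  fixes A :: "real^'n^'n"
  assumes "s \<in> singular_values A"
  obtains v where "norm v > 0" "norm (A *v v) = s * norm v"
proof -
  obtain l v where v: "s = sqrt l" "v \<noteq> 0" "(transpose A ** A) *v v = l *\<^sub>R v"
    using assms by (auto simp: singular_values_def)
  then have "norm (A *v v) = sqrt (l * (norm v)\<^sup>2)"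
    using gram_eigenvalue by (metis norm_ge_zero real_sqrt_unique)
  then have "norm (A *v v) = s * norm v"
    using v by (simp add: real_sqrt_mult)
  with v(2) that show thesis by simp
qed

lemma finite_singular_values: "finite (singular_values (A :: real^'n^'n))"
  unfolding singular_values_def
  by (intro finite_imageI finite_self_adjoint_eigenvalues gram_self_adjoint)

text \<open>The largest eigenvalue of the Gram matrix is obtained as minus the smallest eigenvalue
  of its negative; the root of it is a singular value that bounds the stretching of every
  vector.\<close>

lemma norm_le_singular_value:
  fixes A :: "real^'n^'n"
  obtains s where "s \<in> singular_values A" "\<And>x. norm (A *v x) \<le> s * norm x"
proof -
  let ?f = "\<lambda>x. - ((transpose A ** A) *v x)"
  obtain w :: "real^'n" where w: "w \<noteq> 0"
    by (metis axis_eq_0_iff zero_neq_one)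
  have "linear ?f" by (intro linear_compose_neg matrix_vector_mul_linear)
  then obtain v l where v: "norm v = 1" "?f v = l *\<^sub>R v" "\<And>x. l * (x \<bullet> x) \<le> x \<bullet> ?f x"
    using self_adjoint_min_eigenvector[OF _ subspace_UNIV UNIV_I _ UNIV_I w, of ?f]
    by (metis (no_types, lifting) UNIV_I gram_self_adjoint inner_minus_left inner_minus_right)
  have ev: "(transpose A ** A) *v v = (-l) *\<^sub>R v" using v(2) by (metis minus_equation_iff scaleR_minus_left)
  moreover have "v \<noteq> 0" using v(1) by auto
  ultimately have "sqrt (-l) \<in> singular_values A"
    unfolding singular_values_def by blast
  moreover have "norm (A *v x) \<le> sqrt (-l) * norm x" for x
  proof -
    have "(norm (A *v x))\<^sup>2 \<le> (-l) * (norm x)\<^sup>2"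
      using v(3)[of x] by (simp add: gram_inner power2_norm_eq_inner)
    then have "norm (A *v x) \<le> sqrt ((-l) * (norm x)\<^sup>2)" by (rule real_le_rsqrt)
    then show ?thesis unfolding real_sqrt_mult by simp
  qed
  ultimately show thesis using that by blast
qed

lemma singular_value_le_norm:
  fixes A :: "real^'n^'n"
  obtains s where "s \<in> singular_values A" "\<And>x. s * norm x \<le> norm (A *v x)"
proof -
  let ?f = "\<lambda>x. (transpose A ** A) *v x"
  obtain w :: "real^'n" where w: "w \<noteq> 0"
    by (metis axis_eq_0_iff zero_neq_one)
  obtain v l where v: "norm v = 1" "?f v = l *\<^sub>R v" "\<And>x. l * (x \<bullet> x) \<le> x \<bullet> ?f x"
    using self_adjoint_min_eigenvector[OF matrix_vector_mul_linear subspace_UNIV UNIV_I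
        gram_self_adjoint UNIV_I w]
    by (metis UNIV_I)
  have "v \<noteq> 0" using v(1) by auto
  then have "sqrt l \<in> singular_values A" using v(2) by (auto simp: singular_values_def)
  moreover have "sqrt l * norm x \<le> norm (A *v x)" for x
  proof -
    have "l * (norm x)\<^sup>2 \<le> (norm (A *v x))\<^sup>2"
      using v(3)[of x] by (simp add: gram_inner power2_norm_eq_inner)
    then have "sqrt (l * (norm x)\<^sup>2) \<le> norm (A *v x)"
      by (rule real_le_lsqrt[OF norm_ge_zero])
    then show ?thesis by (simp add: real_sqrt_mult)
  qed
  ultimately show thesis using that by blast
qed

lemma singular_values_nonempty: "singular_values (A :: real^'n^'n) \<noteq> {}"
proof -
  obtain s where "s \<in> singular_values A" by (rule norm_le_singular_value)
  then show ?thesis by auto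
qed

lemma norm_le_sigma_max: "norm (A *v x) \<le> sigma_max (A :: real^'n^'n) * norm x"
proof -
  obtain s where s: "s \<in> singular_values A" "norm (A *v x) \<le> s * norm x"
    using norm_le_singular_value by metis
  then have "s \<le> sigma_max A"
    unfolding sigma_max_def by (intro Max_ge finite_singular_values)
  then have "s * norm x \<le> sigma_max A * norm x" by (simp add: mult_right_mono)
  with s(2) show ?thesis by linarith
qed

lemma sigma_min_le_norm: "sigma_min (A :: real^'n^'n) * norm x \<le> norm (A *v x)"
proof -
  obtain s where s: "s \<in> singular_values A" "s * norm x \<le> norm (A *v x)"
    using singular_value_le_norm by metis
  then have "sigma_min A \<le> s"
    unfolding sigma_min_def by (intro Min_le finite_singular_values)
  then have "sigma_min A * norm x \<le> s * norm x" by (simp add: mult_right_mono)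
  with s(2) show ?thesis by linarith
qed

text \<open>The minimum is itself a singular value, so some nonzero vector is stretched by exactly
  this factor, and the hypothesis is tested on that vector.\<close>

lemma sigma_min_ge:
  fixes A :: "real^'n^'n"
  assumes "\<And>x. c * norm x \<le> norm (A *v x)"
  shows "c \<le> sigma_min A"
proof -
  have "sigma_min A \<in> singular_values A"
    unfolding sigma_min_def by (intro Min_in finite_singular_values singular_values_nonempty)
  then obtain v where "norm v > 0" "norm (A *v v) = sigma_min A * norm v"
    by (rule singular_value_imp_norm)
  then show ?thesis using assms[of v] by simp
qed

lemma sigma_max_le:
  fixes A :: "real^'n^'n"
  assumes "\<And>x. norm (A *v x) \<le> c * norm x"
  shows "sigma_max A \<le> c"
proof -
  have "sigma_max A \<in> singular_values A"
    unfolding sigma_max_def by (intro Max_in finite_singular_values singular_values_nonempty)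
  then obtain v where "norm v > 0" "norm (A *v v) = sigma_max A * norm v"
    by (rule singular_value_imp_norm)
  then show ?thesis using assms[of v] by simp
qed

lemma sigma_min_le_sigma_max: "sigma_min (A :: real^'n^'n) \<le> sigma_max A"
  unfolding sigma_min_def sigma_max_def
  by (intro Min_le Max_in finite_singular_values singular_values_nonempty)

text \<open>The dissipation of the flow involves the transposed Jacobian, so norm bounds have to
  pass to the transpose. Apply the bound to \<open>z = transpose A *v y\<close> and use
  \<open>z \<bullet> z = (A *v z) \<bullet> y\<close>.\<close>

lemma norm_transpose_le:
  fixes A :: "real^'n^'n"
  assumes "\<And>x. norm (A *v x) \<le> c * norm x"
  shows "norm (transpose A *v y) \<le> c * norm y"
proof (cases "transpose A *v y = 0")
  \<comment> \<open>The sign of \<open>c\<close> is not given, so \<open>0 \<le> c * norm y\<close>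
    is read off from the bound on \<open>A\<close>.\<close>
  case True
  have "0 \<le> norm (A *v y)" by (rule norm_ge_zero)
  also have "\<dots> \<le> c * norm y" by (rule assms)
  finally show ?thesis using True by (metis norm_zero)
next
  case False
  let ?z = "transpose A *v y"
  have "norm ?z * norm ?z = (A *v ?z) \<bullet> y"
    by (simp add: inner_matrix_transpose flip: power2_norm_eq_inner power2_eq_square)
  also have "\<dots> \<le> norm (A *v ?z) * norm y" by (rule norm_cauchy_schwarz)
  also have "\<dots> \<le> c * norm ?z * norm y" by (intro mult_right_mono assms) simp
  also have "\<dots> = norm ?z * (c * norm y)" by simp
  finally show ?thesis using False by (simp only: mult_le_cancel_left) simp
qed

text \<open>The lower bound makes the square matrix injective, hence surjective. Writing
  \<open>y = A *v x\<close> gives \<open>y \<bullet> y = x \<bullet> (transpose A *v y)\<close>,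
  where \<open>norm x\<close> is at most \<open>norm y / c\<close>.\<close>

lemma norm_transpose_ge:
  fixes A :: "real^'n^'n"
  assumes "0 < c" and A: "\<And>x. c * norm x \<le> norm (A *v x)"
  shows "c * norm y \<le> norm (transpose A *v y)"
proof (cases "y = 0")
  case False
  have "inj ((*v) A)"
  proof (rule linear_injective_0[THEN iffD2, rule_format])
    show "x = 0" if "A *v x = 0" for x
      using A[of x] that \<open>0 < c\<close> by (simp add: mult_le_0_iff)
  qed simp
  then have "surj ((*v) A)"
    by (simp add: linear_injective_imp_surjective)
  then obtain x where x: "y = A *v x" by (metis surjD)
  have "norm y * norm y = x \<bullet> (transpose A *v y)"
    by (metis inner_matrix_transpose x power2_norm_eq_inner power2_eq_square)
  also have "\<dots> \<le> norm x * norm (transpose A *v y)" by (rule norm_cauchy_schwarz)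
  finally have "c * (norm y * norm y) \<le> (c * norm x) * norm (transpose A *v y)"
    using \<open>0 < c\<close> by (simp add: mult.assoc)
  also have "\<dots> \<le> norm y * norm (transpose A *v y)"
    using A[of x] x by (intro mult_right_mono) auto
  finally have "norm y * (c * norm y) \<le> norm y * norm (transpose A *v y)" by (simp add: mult_ac)
  then show ?thesis using False by simp
qed simp

section \<open>Convergence of the PDHG flow\<close>

text \<open>A difference of squares, and each of its two factors is again one, which leaves four
  linear factors in \<open>x\<close>. The condition on \<open>\<delta>\<close> gives
  \<open>\<bar>\<delta> * x\<bar> < 1\<close>, which makes them all positive. Here \<open>x\<close>
  stands for the square root of a point of the spectrum of \<open>T\<close>.\<close>

lemma dissipation_polynomial_positive:
  fixes \<kappa> \<delta> :: real
  assumes "1 \<le> \<kappa>" "\<bar>\<delta>\<bar> < 1 / \<kappa>" "q = 1 - \<delta>" and x: "1 \<le> x" "x \<le> \<kappa>"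
  shows "0 < 4 * q\<^sup>2 * x\<^sup>2 - (1 - (1 - q\<^sup>2) * x\<^sup>2)\<^sup>2"
proof -
  have "\<bar>\<delta>\<bar> * \<kappa> < 1" using assms by (simp add: field_simps)
  moreover have "\<bar>\<delta>\<bar> * x \<le> \<bar>\<delta>\<bar> * \<kappa>" using x by (simp add: mult_left_mono)
  ultimately have "\<bar>\<delta> * x\<bar> < 1" using x by (simp add: abs_mult)
  then have *: "- 1 < \<delta> * x" "\<delta> * x < 1" by auto
  have "\<bar>\<delta>\<bar> * 1 \<le> \<bar>\<delta>\<bar> * \<kappa>" using assms by (intro mult_left_mono) auto
  then have "\<bar>\<delta>\<bar> < 1" using \<open>\<bar>\<delta>\<bar> * \<kappa> < 1\<close> by simp
  then have q: "q > 0" using assms by auto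
  have "4 * q\<^sup>2 * x\<^sup>2 - (1 - (1 - q\<^sup>2) * x\<^sup>2)\<^sup>2
      = ((2 * x - \<delta> * x - 1) * (1 + \<delta> * x)) * ((1 - \<delta> * x) * (1 + q * x + x))"
    by (simp add: assms(3) algebra_simps power2_eq_square)
  also have "\<dots> > 0"
  proof (intro mult_pos_pos)
    show "0 < 1 + q * x + x" using x q by (intro add_pos_pos mult_pos_pos) auto
  qed (use * x in linarith)+
  finally show ?thesis .
qed

text \<open>Completing the square in \<open>y\<close> reduces the claim to strict positivity of the concave polynomial
  \<open>4 * q\<^sup>2 * p - (1 - (1 - q\<^sup>2) * p)\<^sup>2\<close> at \<open>p = T\<close>. It exceeds its chord over \<open>{1..\<kappa>\<^sup>2}\<close> by a
  multiple of \<open>(p - 1) * (\<kappa>\<^sup>2 - p)\<close>, and \<open>(T - 1) (\<kappa>\<^sup>2 - T)\<close> is non-negative, so positivity at the two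
  endpoints suffices.\<close>

lemma pdhg_dissipation:
  fixes \<kappa> \<delta> q :: real
  assumes \<kappa>: "1 \<le> \<kappa>" and \<delta>: "\<bar>\<delta>\<bar> < 1 / \<kappa>" and q_def: "q = 1 - \<delta>"
  shows "\<exists>c>0. \<forall>(T::'a::euclidean_space \<Rightarrow> 'a) x y.
    linear T \<longrightarrow> (\<forall>x y. T x \<bullet> y = x \<bullet> T y) \<longrightarrow>
    (\<forall>x. x \<bullet> x \<le> x \<bullet> T x) \<longrightarrow> (\<forall>x. x \<bullet> T x \<le> \<kappa>\<^sup>2 * (x \<bullet> x)) \<longrightarrow>
    c * (q / \<kappa> * (x \<bullet> x) + q * \<kappa> * (y \<bullet> y))
      \<le> q / \<kappa> * (x \<bullet> T x) + q * \<kappa> * (y \<bullet> y) - y \<bullet> (x - (1 - q\<^sup>2) *\<^sub>R T x)"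
proof -
  define K m where "K = \<kappa>\<^sup>2" and "m = 1 - q\<^sup>2"
  \<comment> \<open>\<open>\<alpha> * p + \<beta>\<close> is the chord of the polynomial over
    \<open>{1..K}\<close>: replace \<open>p\<^sup>2\<close> by \<open>(K + 1) * p - K\<close>, which
    agrees with it at both endpoints. Then \<open>g\<close> is the minimum of the chord.\<close>
  define \<alpha> \<beta> where "\<alpha> = 4 * q\<^sup>2 + 2 * m - m\<^sup>2 * (K + 1)" and "\<beta> = m\<^sup>2 * K - 1"
  define g where "g = min (\<alpha> + \<beta>) (\<alpha> * K + \<beta>)"
  \<comment> \<open>The margin \<open>g\<close> relative to \<open>4 * q\<^sup>2 * K\<close>, the
    largest value of \<open>4 * q\<^sup>2 * p\<close> on the interval.\<close>
  define \<rho> where "\<rho> = g / (4 * q\<^sup>2 * K)"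
  have K1: "1 \<le> K" using \<kappa> by (simp add: K_def)
  have "\<bar>\<delta>\<bar> * 1 \<le> \<bar>\<delta>\<bar> * \<kappa>" using \<kappa> by (intro mult_left_mono) auto
  then have q: "q > 0" using \<delta> \<kappa> q_def by (auto simp: field_simps)
  have g1: "\<alpha> + \<beta> = 4 * q\<^sup>2 - (1 - m)\<^sup>2"
    by (simp add: \<alpha>_def \<beta>_def algebra_simps power2_eq_square)
  have gK: "\<alpha> * K + \<beta> = 4 * q\<^sup>2 * K - (1 - m * K)\<^sup>2"
    by (simp add: \<alpha>_def \<beta>_def algebra_simps power2_eq_square)
  have "0 < g"
    using dissipation_polynomial_positive[OF \<kappa> \<delta> q_def, of 1] \<kappa>
      dissipation_polynomial_positive[OF \<kappa> \<delta> q_def, of \<kappa>]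
    by (simp add: g_def g1 gK flip: K_def m_def)
  then have \<rho>0: "\<rho> > 0" using q K1 by (simp add: \<rho>_def)
  have "g \<le> 4 * q\<^sup>2" by (simp add: g_def g1 min_le_iff_disj)
  also have "\<dots> \<le> 4 * q\<^sup>2 * K" using K1 mult_left_mono[of 1 K "4 * q\<^sup>2"] by simp
  finally have \<rho>1: "\<rho> \<le> 1" using q K1 by (simp add: \<rho>_def)
  \<comment> \<open>A root-free upper bound for the square root of \<open>1 - \<rho>\<close>. What
    it leaves, \<open>\<rho> / 2\<close>, becomes the constant \<open>c\<close> of the
    claim.\<close>
  define \<theta> where "\<theta> = 1 - \<rho> / 2"
  have \<theta>: "0 \<le> \<theta>" "1 - \<rho> \<le> \<theta>\<^sup>2"
    using \<rho>1 by (auto simp: \<theta>_def power2_eq_square algebra_simps)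
  have main: "\<rho> / 2 * (q / \<kappa> * (x \<bullet> x) + q * \<kappa> * (y \<bullet> y))
      \<le> q / \<kappa> * (x \<bullet> T x) + q * \<kappa> * (y \<bullet> y) - y \<bullet> (x - m *\<^sub>R T x)"
    if T: "linear T" and adj: "\<And>x y. T x \<bullet> y = x \<bullet> T y"
      and lo: "\<And>x. x \<bullet> x \<le> x \<bullet> T x" and hi: "\<And>x. x \<bullet> T x \<le> K * (x \<bullet> x)"
    for T :: "'a \<Rightarrow> 'a" and x y
  proof -
    interpret T: linear T by (rule T)
    define X n Y where "X = x \<bullet> T x" and "n = x \<bullet> x" and "Y = y \<bullet> y"
    have nX: "n \<le> X" "X \<le> K * n" "0 \<le> n" "0 \<le> Y"
      using lo[of x] hi[of x] by (auto simp: X_def n_def Y_def)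
    \<comment> \<open>The maps \<open>T - 1\<close> and \<open>K - T\<close> commute and are
      nonnegative, so their product is nonnegative. This is the operator form of
      \<open>p\<^sup>2 \<le> (K + 1) * p - K\<close>.\<close>
    have "0 \<le> x \<bullet> (T (K *\<^sub>R x - T x) - (K *\<^sub>R x - T x))"
    proof (rule commuting_nonneg_product[of "\<lambda>x. T x - x" "\<lambda>x. K *\<^sub>R x - T x"])
      show "linear (\<lambda>x. T x - x)" "linear (\<lambda>x. K *\<^sub>R x - T x)"
        by (auto intro!: linear_compose_sub T linear_ident linear_scaleR)
    qed (auto simp: adj lo hi inner_diff_left inner_diff_right T.diff T.scaleR scaleR_diff_right)
    then have TT: "T x \<bullet> T x \<le> (K + 1) * X - K * n"
      by (simp add: X_def n_def T.diff T.scaleR inner_diff_right adj algebra_simps)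
    have "(norm (x - m *\<^sub>R T x))\<^sup>2 = n - 2 * m * X + m\<^sup>2 * (T x \<bullet> T x)"
      unfolding power2_norm_eq_inner
      by (simp add: X_def n_def inner_diff_left inner_diff_right inner_commute[of "T x" x]
          power2_eq_square algebra_simps)
    also have "\<dots> \<le> n - 2 * m * X + m\<^sup>2 * ((K + 1) * X - K * n)"
      using TT by (simp add: mult_left_mono)
    also have "\<dots> = 4 * q\<^sup>2 * X - (\<alpha> * X + \<beta> * n)"
      by (simp add: \<alpha>_def \<beta>_def algebra_simps)
    finally have "(norm (x - m *\<^sub>R T x))\<^sup>2 \<le> 4 * q\<^sup>2 * X - (\<alpha> * X + \<beta> * n)" .
    \<comment> \<open>For fixed \<open>n\<close> the left end \<open>X = n\<close> or the right end
      \<open>X = K * n\<close> is the minimum of the affine right-hand side, depending on the sign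
      of \<open>\<alpha>\<close>.\<close>
    moreover have "g * n \<le> \<alpha> * X + \<beta> * n"
    proof (cases "\<alpha> \<ge> 0")
      case True
      have "g * n \<le> (\<alpha> + \<beta>) * n" using nX by (intro mult_right_mono) (auto simp: g_def)
      also have "\<dots> \<le> \<alpha> * X + \<beta> * n"
        using mult_left_mono[OF nX(1) True] by (simp add: algebra_simps)
      finally show ?thesis .
    next
      case False
      have "g * n \<le> (\<alpha> * K + \<beta>) * n" using nX by (intro mult_right_mono) (auto simp: g_def)
      also have "\<dots> \<le> \<alpha> * X + \<beta> * n"
        using mult_left_mono_neg[OF nX(2), of \<alpha>] False by (simp add: algebra_simps)
      finally show ?thesis .
    qed
    moreover have "\<rho> * (4 * q\<^sup>2 * X) \<le> g * n"
    proof -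
      have "\<rho> * (4 * q\<^sup>2 * X) \<le> \<rho> * (4 * q\<^sup>2 * (K * n))"
        using nX \<rho>0 by (intro mult_left_mono) auto
      also have "\<dots> = g * n" using q K1 by (simp add: \<rho>_def)
      finally show ?thesis .
    qed
    ultimately have "(norm (x - m *\<^sub>R T x))\<^sup>2 \<le> (1 - \<rho>) * (4 * q\<^sup>2 * X)"
      by (simp add: algebra_simps)
    also have "\<dots> \<le> \<theta>\<^sup>2 * (4 * q\<^sup>2 * X)"
      using \<theta> nX by (intro mult_right_mono) auto
    finally have P: "(norm (x - m *\<^sub>R T x))\<^sup>2 \<le> \<theta>\<^sup>2 * (4 * q\<^sup>2 * X)" .
    \<comment> \<open>The factors \<open>\<kappa>\<close> cancel in the product of the two summands,
      so the arithmetic-geometric mean inequality gives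
      \<open>4 * q\<^sup>2 * X * Y \<le> Z\<^sup>2\<close>. Together with \<open>P\<close> this
      bounds the cross term by \<open>\<theta> * Z\<close>.\<close>
    define Z where "Z = q / \<kappa> * X + q * \<kappa> * Y"
    have Z0: "0 \<le> Z" using nX q \<kappa> by (simp add: Z_def)
    have "(norm y * norm (x - m *\<^sub>R T x))\<^sup>2 = Y * (norm (x - m *\<^sub>R T x))\<^sup>2"
      by (simp add: power_mult_distrib Y_def power2_norm_eq_inner)
    also have "\<dots> \<le> Y * (\<theta>\<^sup>2 * (4 * q\<^sup>2 * X))" using P nX by (intro mult_left_mono) auto
    also have "\<dots> = \<theta>\<^sup>2 * (4 * ((q / \<kappa> * X) * (q * \<kappa> * Y)))"
      using \<kappa> by (simp add: power2_eq_square)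
    also have "\<dots> \<le> \<theta>\<^sup>2 * Z\<^sup>2"
    proof (rule mult_left_mono)
      have "0 \<le> (q / \<kappa> * X - q * \<kappa> * Y)\<^sup>2" by simp
      also have "\<dots> = Z\<^sup>2 - 4 * ((q / \<kappa> * X) * (q * \<kappa> * Y))"
        unfolding Z_def by (simp add: power2_diff power2_sum)
      finally show "4 * ((q / \<kappa> * X) * (q * \<kappa> * Y)) \<le> Z\<^sup>2" by simp
    qed simp
    finally have "(norm y * norm (x - m *\<^sub>R T x))\<^sup>2 \<le> (\<theta> * Z)\<^sup>2"
      by (simp add: power_mult_distrib)
    then have "norm y * norm (x - m *\<^sub>R T x) \<le> \<theta> * Z"
      by (rule power2_le_imp_le) (use \<theta> Z0 in simp)
    then have "y \<bullet> (x - m *\<^sub>R T x) \<le> \<theta> * Z"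
      using norm_cauchy_schwarz[of y "x - m *\<^sub>R T x"] by linarith
    moreover have "\<rho> / 2 * (q / \<kappa> * n + q * \<kappa> * Y) \<le> \<rho> / 2 * Z"
      unfolding Z_def using nX q \<kappa> \<rho>0 by (intro mult_left_mono add_right_mono) auto
    ultimately have "\<rho> / 2 * (q / \<kappa> * n + q * \<kappa> * Y) \<le> Z - y \<bullet> (x - m *\<^sub>R T x)"
      by (simp add: \<theta>_def algebra_simps)
    then show ?thesis by (simp add: Z_def X_def n_def Y_def)
  qed
  show ?thesis
    using \<rho>0 by (intro exI[of _ "\<rho> / 2"] conjI allI impI main[unfolded K_def m_def]) auto
qed

text \<open>The integrating factor \<open>exp (r * s)\<close> turns the differential inequality into
  monotonicity. The mean value theorem is applied with derivatives within the interval, which covers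
  the one-sided derivative at time 0.\<close>

lemma exponential_decay:
  fixes g :: "real \<Rightarrow> real"
  assumes deriv: "\<And>t. 0 \<le> t \<Longrightarrow> (g has_vector_derivative g' t) (at t within {0..})"
    and le: "\<And>t. 0 \<le> t \<Longrightarrow> g' t \<le> - r * g t"
    and t: "0 \<le> t"
  shows "g t \<le> g 0 * exp (- r * t)"
proof -
  define G where "G s = exp (r * s) * g s" for s
  have "\<exists>s\<in>{0..t}. G t - G 0 = (\<lambda>h. h *\<^sub>R (exp (r * s) * (g' s + r * g s))) (t - 0)"
  proof (rule mvt_very_simple[OF t])
    fix s assume s: "0 \<le> s" "s \<le> t"
    have "(g has_vector_derivative g' s) (at s within {0..t})"
      using deriv[OF s(1)] by (rule has_vector_derivative_within_subset) auto
    then have "(g has_field_derivative g' s) (at s within {0..t})"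
      by (simp add: has_real_derivative_iff_has_vector_derivative)
    then have "(G has_field_derivative exp (r * s) * (g' s + r * g s)) (at s within {0..t})"
      unfolding G_def by (auto intro!: derivative_eq_intros simp: algebra_simps)
    then show "(G has_derivative (\<lambda>h. h *\<^sub>R (exp (r * s) * (g' s + r * g s)))) (at s within {0..t})"
      by (simp add: has_field_derivative_def mult_commute_abs)
  qed
  then obtain s where s: "0 \<le> s" "G t - G 0 = t * (exp (r * s) * (g' s + r * g s))" by auto
  have "t * (exp (r * s) * (g' s + r * g s)) \<le> 0"
    using le[OF s(1)] t by (intro mult_nonneg_nonpos) auto
  then have "exp (r * t) * g t \<le> g 0" using s by (simp add: G_def)
  then have "exp (- r * t) * (exp (r * t) * g t) \<le> exp (- r * t) * g 0"
    by (intro mult_left_mono) auto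
  moreover have "exp (- r * t) * (exp (r * t) * g t) = g t"
    by (simp add: exp_minus)
  ultimately show ?thesis by (metis mult.commute)
qed

lemma pdhg_flow_exponential_convergence:
  fixes F :: "real^'n \<Rightarrow> real^'n"
  assumes diff: "\<And>x. F differentiable (at x)"
    and lo: "\<And>x v. s * norm v \<le> norm (jacobian F (at x) *v v)"
    and hi: "\<And>x v. norm (jacobian F (at x) *v v) \<le> S * norm v"
    and s: "0 < s" "s \<le> S" and \<kappa>_def: "\<kappa> = S / s"
    and \<delta>: "\<bar>\<delta>\<bar> < 1 / \<kappa>" and \<gamma>_def: "\<gamma> = (1 - \<delta>) / \<kappa>" and \<epsilon>_def: "\<epsilon> = (1 - \<delta>) * \<kappa>"
    and flow: "pdhg_flow F \<gamma> \<epsilon> U Q"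
  shows "\<exists>C\<ge>0. \<exists>r>0. \<forall>t\<ge>0. norm (F (U t)) \<le> C * exp (- r * t)"
proof -
  \<comment> \<open>The weight \<open>\<mu>\<close> scales \<open>D D\<^sup>T\<close> so that its
    spectrum lies between 1 and \<open>\<kappa>\<^sup>2\<close>, as \<open>pdhg_dissipation\<close>
    requires.\<close>
  define q \<mu> where "q = 1 - \<delta>" and "\<mu> = 1 / s\<^sup>2"
  have \<kappa>: "1 \<le> \<kappa>" and \<mu>: "0 < \<mu>" using s by (auto simp: \<kappa>_def \<mu>_def)
  have "\<bar>\<delta>\<bar> * 1 \<le> \<bar>\<delta>\<bar> * \<kappa>" using \<kappa> by (intro mult_left_mono) auto
  then have q: "q > 0" using \<delta> \<kappa> q_def by (auto simp: field_simps)
  have \<gamma>: "\<gamma> = q / \<kappa>" "\<gamma> > 0" and \<epsilon>: "\<epsilon> = q * \<kappa>" "\<epsilon> > 0" and \<gamma>\<epsilon>: "1 - \<gamma> * \<epsilon> = 1 - q\<^sup>2"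
    using \<kappa> q by (auto simp: \<gamma>_def \<epsilon>_def q_def power2_eq_square)
  obtain c where c: "c > 0" and diss:
    "\<forall>(T::real^'n \<Rightarrow> real^'n) x y. linear T \<longrightarrow> (\<forall>x y. T x \<bullet> y = x \<bullet> T y) \<longrightarrow>
      (\<forall>x. x \<bullet> x \<le> x \<bullet> T x) \<longrightarrow> (\<forall>x. x \<bullet> T x \<le> \<kappa>\<^sup>2 * (x \<bullet> x)) \<longrightarrow>
      c * (q / \<kappa> * (x \<bullet> x) + q * \<kappa> * (y \<bullet> y))
        \<le> q / \<kappa> * (x \<bullet> T x) + q * \<kappa> * (y \<bullet> y) - y \<bullet> (x - (1 - q\<^sup>2) *\<^sub>R T x)"
    using pdhg_dissipation[OF \<kappa> \<delta> q_def] by blast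
  define J where "J t = jacobian F (at (U t))" for t
  define T where "T t x = \<mu> *\<^sub>R (J t *v (transpose (J t) *v x))" for t x
  \<comment> \<open>Half the dissipation rate: the energy \<open>I\<close> defined next has
    derivative \<open>- (2 * E t)\<close> along the flow.\<close>
  define E where "E t = \<gamma> * (F (U t) \<bullet> T t (F (U t))) + \<epsilon> * (Q t \<bullet> Q t)
      - Q t \<bullet> (F (U t) - (1 - q\<^sup>2) *\<^sub>R T t (F (U t)))" for t
  define I where "I t = \<mu> * (F (U t) \<bullet> F (U t)) + Q t \<bullet> Q t" for t
  have T_inner: "x \<bullet> T t y = \<mu> * ((transpose (J t) *v x) \<bullet> (transpose (J t) *v y))" for t x y
    by (simp only: T_def inner_scaleR_right inner_matrix_transpose transpose_transpose)
  then have T_adjoint: "T t x \<bullet> y = x \<bullet> T t y" for t x y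
    by (metis inner_commute)
  have T_linear: "linear (T t)" for t
    unfolding T_def matrix_vector_mul_assoc
    by (intro linear_compose_scale_right matrix_vector_mul_linear)
  have E: "c * (\<gamma> * (F (U t) \<bullet> F (U t)) + \<epsilon> * (Q t \<bullet> Q t)) \<le> E t" for t
    unfolding E_def \<gamma>(1) \<epsilon>(1)
  proof (intro diss[rule_format])
    show "linear (T t)" by (rule T_linear)
    show "T t x \<bullet> y = x \<bullet> T t y" for x y
      by (rule T_adjoint)
    show "x \<bullet> x \<le> x \<bullet> T t x" for x
    proof -
      have "s * norm x \<le> norm (transpose (J t) *v x)"
        unfolding J_def by (rule norm_transpose_ge[OF s(1) lo])
      then have "(s * norm x)\<^sup>2 \<le> (norm (transpose (J t) *v x))\<^sup>2"
        using s by (intro power_mono) auto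
      then show ?thesis
        unfolding T_inner power_mult_distrib power2_norm_eq_inner
        using s by (simp add: \<mu>_def field_simps)
    qed
    show "x \<bullet> T t x \<le> \<kappa>\<^sup>2 * (x \<bullet> x)" for x
    proof -
      have "norm (transpose (J t) *v x) \<le> S * norm x"
        unfolding J_def by (rule norm_transpose_le[OF hi])
      then have "(norm (transpose (J t) *v x))\<^sup>2 \<le> (S * norm x)\<^sup>2"
        by (intro power_mono) auto
      then show ?thesis
        unfolding T_inner power_mult_distrib power2_norm_eq_inner
        using s by (simp add: \<mu>_def \<kappa>_def power_divide divide_right_mono)
    qed
  qed
  have I': "(I has_vector_derivative - (2 * E t)) (at t within {0..})" if t: "0 \<le> t" for t
  proof -
    let ?w = "- (transpose (J t) *v ((1 - \<gamma> * \<epsilon>) *\<^sub>R Q t + \<gamma> *\<^sub>R F (U t)))"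
    have dQ: "(Q has_vector_derivative - (\<epsilon> *\<^sub>R Q t) + F (U t)) (at t within {0..})"
      and dU: "(U has_vector_derivative ?w) (at t within {0..})"
      using flow t unfolding pdhg_flow_def J_def by auto
    have "(F has_derivative (*v) (J t)) (at (U t) within U ` {0..})"
      using diff jacobian_works unfolding J_def by (metis has_derivative_at_withinI)
    from vector_derivative_diff_chain_within[OF dU this]
    have dF: "((\<lambda>t. F (U t)) has_vector_derivative J t *v ?w) (at t within {0..})"
      by (simp add: o_def)
    have energy: "\<mu> * (p \<bullet> z + z \<bullet> p) + (y \<bullet> (- (\<epsilon> *\<^sub>R y) + p) + (- (\<epsilon> *\<^sub>R y) + p) \<bullet> y)
        = 2 * (p \<bullet> (\<mu> *\<^sub>R z) - \<epsilon> * (y \<bullet> y) + y \<bullet> p)" for p y z :: "real^'n"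
      by (simp add: inner_diff_left inner_diff_right inner_commute[of z p] inner_commute[of p y])
    note inner = bounded_bilinear.has_vector_derivative[OF bounded_bilinear_inner]
    have "(I has_vector_derivative
        \<mu> * (F (U t) \<bullet> (J t *v ?w) + (J t *v ?w) \<bullet> F (U t))
        + (Q t \<bullet> (- (\<epsilon> *\<^sub>R Q t) + F (U t)) + (- (\<epsilon> *\<^sub>R Q t) + F (U t)) \<bullet> Q t)) (at t within {0..})"
      unfolding I_def
      by (intro has_vector_derivative_add has_vector_derivative_mult_right inner dQ dF)
    also have "\<mu> * (F (U t) \<bullet> (J t *v ?w) + (J t *v ?w) \<bullet> F (U t))
        + (Q t \<bullet> (- (\<epsilon> *\<^sub>R Q t) + F (U t)) + (- (\<epsilon> *\<^sub>R Q t) + F (U t)) \<bullet> Q t)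
      = 2 * (F (U t) \<bullet> (\<mu> *\<^sub>R (J t *v ?w)) - \<epsilon> * (Q t \<bullet> Q t) + Q t \<bullet> F (U t))"
      by (rule energy)
    also have "\<mu> *\<^sub>R (J t *v ?w) = - T t ((1 - q\<^sup>2) *\<^sub>R Q t + \<gamma> *\<^sub>R F (U t))"
      by (simp only: T_def \<gamma>\<epsilon> linear_neg[OF matrix_vector_mul_linear] scaleR_minus_right)
    also have "\<dots> = - ((1 - q\<^sup>2) *\<^sub>R T t (Q t) + \<gamma> *\<^sub>R T t (F (U t)))"
      by (simp only: T_linear[THEN linear_add] T_linear[THEN linear_scale])
    \<comment> \<open>Self-adjointness moves \<open>T t\<close> from \<open>Q t\<close> to
      \<open>F (U t)\<close>, which gives the cross term the form it has in
      \<open>E\<close>.\<close>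
    also have "F (U t) \<bullet> - ((1 - q\<^sup>2) *\<^sub>R T t (Q t) + \<gamma> *\<^sub>R T t (F (U t)))
        = - ((1 - q\<^sup>2) * (Q t \<bullet> T t (F (U t)))) - \<gamma> * (F (U t) \<bullet> T t (F (U t)))"
    proof -
      have "F (U t) \<bullet> T t (Q t) = Q t \<bullet> T t (F (U t))"
        by (metis T_adjoint inner_commute)
      then show ?thesis by (simp add: inner_diff_right)
    qed
    finally show ?thesis
      by (simp add: E_def inner_diff_right algebra_simps)
  qed
  \<comment> \<open>The part of \<open>I\<close> in \<open>F\<close> has weight \<open>\<mu>\<close>
    and is dissipated with weight \<open>\<gamma>\<close>, the part in \<open>Q\<close> with weight
    \<open>\<epsilon>\<close>. The slower of the rates \<open>\<gamma> / \<mu>\<close> and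
    \<open>\<epsilon>\<close> serves for both.\<close>
  define r where "r = c * min (\<gamma> / \<mu>) \<epsilon>"
  have r: "r > 0" using c \<gamma>(2) \<epsilon>(2) \<mu> by (simp add: r_def)
  have "- (2 * E t) \<le> - (2 * r) * I t" for t
  proof -
    have "min (\<gamma> / \<mu>) \<epsilon> * I t \<le> \<gamma> * (F (U t) \<bullet> F (U t)) + \<epsilon> * (Q t \<bullet> Q t)"
    proof -
      have "min (\<gamma> / \<mu>) \<epsilon> * (\<mu> * (F (U t) \<bullet> F (U t))) \<le> \<gamma> / \<mu> * (\<mu> * (F (U t) \<bullet> F (U t)))"
        using \<mu> by (intro mult_right_mono) auto
      moreover have "min (\<gamma> / \<mu>) \<epsilon> * (Q t \<bullet> Q t) \<le> \<epsilon> * (Q t \<bullet> Q t)"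
        by (intro mult_right_mono) auto
      ultimately show ?thesis using \<mu> by (simp add: I_def distrib_left)
    qed
    then have "r * I t \<le> c * (\<gamma> * (F (U t) \<bullet> F (U t)) + \<epsilon> * (Q t \<bullet> Q t))"
      using c by (simp add: r_def mult.assoc)
    with E[of t] show ?thesis by simp
  qed
  then have decay: "I t \<le> I 0 * exp (- (2 * r) * t)" if "0 \<le> t" for t
    using exponential_decay[OF I'] that by blast
  \<comment> \<open>The energy controls the squared norm, so taking roots halves the rate
    \<open>2 * r\<close>.\<close>
  have "norm (F (U t)) \<le> sqrt (I 0 / \<mu>) * exp (- r * t)" if t: "0 \<le> t" for t
  proof -
    have "\<mu> * (norm (F (U t)))\<^sup>2 \<le> I t"
      by (simp add: I_def power2_norm_eq_inner)
    also have "\<dots> \<le> I 0 * exp (- (2 * r) * t)" by (rule decay[OF t])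
    also have "exp (- (2 * r) * t) = (exp (- r * t))\<^sup>2"
      by (simp add: power2_eq_square flip: exp_add)
    finally have "(norm (F (U t)))\<^sup>2 \<le> I 0 / \<mu> * (exp (- r * t))\<^sup>2"
      using \<mu> by (simp add: pos_le_divide_eq mult.commute)
    then have "norm (F (U t)) \<le> sqrt (I 0 / \<mu> * (exp (- r * t))\<^sup>2)" by (rule real_le_rsqrt)
    then show ?thesis unfolding real_sqrt_mult by simp
  qed
  moreover have "0 \<le> sqrt (I 0 / \<mu>)" using \<mu> by (simp add: I_def)
  ultimately show ?thesis using r by blast
qed

section \<open>The time-implicit scheme\<close>

definition slice :: "real^('t::finite \<times> 's::finite) \<Rightarrow> 't \<Rightarrow> real^'s" where
  "slice v k = (\<chi> i. v $ (k, i))"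

lemma slice_nth [simp]: "slice v k $ i = v $ (k, i)"
  by (simp add: slice_def)

lemma slice_add: "slice (v + w) k = slice v k + slice w k"
  and slice_scaleR: "slice (c *\<^sub>R v) k = c *\<^sub>R slice v k"
  by (simp_all add: vec_eq_iff)

lemma sum_UNIV_prod:
  "(\<Sum>p\<in>UNIV. g p) = (\<Sum>k\<in>UNIV. \<Sum>i\<in>UNIV. g (k, i))"
  for g :: "'t::finite \<times> 's::finite \<Rightarrow> 'c::comm_monoid_add"
  by (simp add: sum.cartesian_product flip: UNIV_Times_UNIV)

lemma kronecker_mult_nth:
  "(kronecker A B *v x) $ (k, i) = (\<Sum>l\<in>UNIV. \<Sum>j\<in>UNIV. A $ k $ l * B $ i $ j * x $ (l, j))"
  by (simp add: matrix_vector_mult_def kronecker_def sum_UNIV_prod)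

lemma slice_kronecker_id_left: "slice (kronecker (mat 1) B *v x) k = B *v slice x k"
proof -
  have "(\<Sum>l\<in>UNIV. \<Sum>j\<in>UNIV. mat 1 $ k $ l * B $ i $ j * x $ (l, j))
      = (\<Sum>l\<in>UNIV. if l = k then \<Sum>j\<in>UNIV. B $ i $ j * x $ (l, j) else 0)" for i
    by (intro sum.cong) (auto simp: mat_def)
  then show ?thesis
    by (simp add: vec_eq_iff kronecker_mult_nth) (simp add: matrix_vector_mult_def)
qed

lemma slice_kronecker_id_right:
  "slice (kronecker A (mat 1) *v x) k = (\<Sum>l\<in>UNIV. A $ k $ l *\<^sub>R slice x l)"
proof -
  have "(\<Sum>j\<in>UNIV. A $ k $ l * mat 1 $ i $ j * x $ (l, j))
      = (\<Sum>j\<in>UNIV. if j = i then A $ k $ l * x $ (l, j) else 0)" for l i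
    by (intro sum.cong) (auto simp: mat_def)
  then show ?thesis
    by (simp add: vec_eq_iff kronecker_mult_nth)
qed

lemma norm_eq_L2_set_slices: "norm v = L2_set (\<lambda>k. norm (slice v k)) UNIV"
proof -
  have "(norm v)\<^sup>2 = (\<Sum>k\<in>UNIV. (norm (slice v k))\<^sup>2)"
    by (simp add: power2_norm_eq_inner inner_vec_def sum_UNIV_prod)
  then show ?thesis by (metis L2_set_def norm_ge_zero real_sqrt_unique)
qed

lemma norm_slice_le: "norm (slice v k) \<le> norm v"
  unfolding norm_eq_L2_set_slices[of v] by (rule member_le_L2_set) auto

lemma norm_le_sum_slices: "norm v \<le> (\<Sum>k\<in>UNIV. norm (slice v k))"
  unfolding norm_eq_L2_set_slices by (rule L2_set_le_sum) auto

text \<open>The remainder is the slice at the immediate predecessor of \<open>k\<close>, or 0 at the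
  first level. Bounding it by the sum over all earlier levels avoids naming the predecessor.\<close>

lemma norm_backward_diff_remainder:
  fixes v :: "real^('t::{finite,linorder} \<times> 's::finite)"
  shows "norm (slice v k - slice (kronecker backward_diff (mat 1) *v v) k)
    \<le> (\<Sum>l\<in>{..<k}. norm (slice v l))"
proof -
  have "slice v k - slice (kronecker backward_diff (mat 1) *v v) k
      = (\<Sum>l\<in>UNIV. (if l = k then slice v l else 0) - backward_diff $ k $ l *\<^sub>R slice v l)"
    by (simp add: slice_kronecker_id_right sum_subtractf)
  also have "\<dots> = (\<Sum>l\<in>{..<k}. if {l<..<k} = {} then slice v l else 0)"
    by (rule sum.mono_neutral_cong_right) (auto simp: backward_diff_def)
  also have "norm \<dots> \<le> (\<Sum>l\<in>{..<k}. norm (slice v l))"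
    by (rule sum_norm_le) auto
  finally show ?thesis .
qed

text \<open>Induction on the number of earlier levels gives each level \<open>k\<close> its own
  constant, \<open>(1 + (\<Sum>l\<in>{..<k}. C l)) / \<theta>\<close>. The constants are chosen
  before \<open>z\<close> and \<open>y\<close>, and this makes the final bound uniform in the base
  point.\<close>

lemma discrete_gronwall_finite:
  fixes \<theta> :: real
  assumes "\<theta> > 0"
  shows "\<exists>C\<ge>0. \<forall>(z :: 't::{finite,linorder} \<Rightarrow> real) y. 0 \<le> y \<longrightarrow>
    (\<forall>k. \<theta> * z k \<le> y + (\<Sum>l\<in>{..<k}. z l)) \<longrightarrow> (\<Sum>k\<in>UNIV. z k) \<le> C * y"
proof -
  let ?hyp = "\<lambda>(z :: 't \<Rightarrow> real) y. 0 \<le> y \<and> (\<forall>k. \<theta> * z k \<le> y + (\<Sum>l\<in>{..<k}. z l))"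
  have ex: "\<exists>C\<ge>0. \<forall>z y. ?hyp z y \<longrightarrow> z k \<le> C * y" for k :: 't
  proof (induction "card {..<k}" arbitrary: k rule: less_induct)
    case less
    have "\<exists>C. C \<ge> 0 \<and> (\<forall>z y. ?hyp z y \<longrightarrow> z l \<le> C * y)" if "l \<in> {..<k}" for l
    proof -
      have "{..<l} \<subset> {..<k}" using that by auto
      then have "card {..<l} < card {..<k}" by (intro psubset_card_mono) auto
      from less[OF this] show ?thesis by blast
    qed
    then obtain C where C: "\<And>l. l \<in> {..<k} \<Longrightarrow> C l \<ge> 0"
      "\<And>l z y. l \<in> {..<k} \<Longrightarrow> ?hyp z y \<Longrightarrow> z l \<le> C l * y" by metis
    have "z k \<le> (1 + (\<Sum>l\<in>{..<k}. C l)) / \<theta> * y" if "?hyp z y" for z y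
    proof -
      have "\<theta> * z k \<le> y + (\<Sum>l\<in>{..<k}. z l)" using that by blast
      also have "\<dots> \<le> y + (\<Sum>l\<in>{..<k}. C l * y)"
        using C(2) that by (intro add_left_mono sum_mono) blast
      also have "\<dots> = (1 + (\<Sum>l\<in>{..<k}. C l)) * y"
        by (simp add: sum_distrib_right distrib_right)
      finally show ?thesis using assms by (simp add: field_simps)
    qed
    moreover have "(1 + (\<Sum>l\<in>{..<k}. C l)) / \<theta> \<ge> 0"
      using assms C(1) by (intro divide_nonneg_pos add_nonneg_nonneg sum_nonneg) auto
    ultimately show ?case by blast
  qed
  then obtain C :: "'t \<Rightarrow> real" where C: "\<And>k. C k \<ge> 0" "\<And>k z y. ?hyp z y \<Longrightarrow> z k \<le> C k * y"
    by metis
  have "(\<Sum>k\<in>UNIV. z k) \<le> (\<Sum>k\<in>UNIV. C k) * y" if "?hyp z y" for z y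
    unfolding sum_distrib_right using C(2)[OF that] by (intro sum_mono)
  moreover have "(\<Sum>k\<in>UNIV. C k) \<ge> 0" using C(1) by (intro sum_nonneg)
  ultimately show ?thesis by blast
qed

section \<open>Bounds for the linearized scheme that are uniform in the base point\<close>

lemma norm_matrix_vector_le: "norm (A *v x) \<le> onorm ((*v) A) * norm x"
  for A :: "real^'n^'m"
  by (intro onorm matrix_vector_mul_bounded_linear)

text \<open>Pair the vector on the right with \<open>v\<close>: the product term contributes
  nonnegatively, and Cauchy-Schwarz finishes. Thus the implicit linear term imposes no smallness
  condition on the time step.\<close>

lemma norm_le_norm_id_plus_product:
  fixes G L :: "real^'s^'s"
  assumes "transpose G = G" "nonneg_definite G" "transpose L = L" "nonneg_definite L"
    and "G ** L = L ** G" and "0 \<le> c"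
  shows "norm v \<le> norm (v + c *\<^sub>R (G *v (L *v v)))"
proof (cases "v = 0")
  case False
  have "0 \<le> v \<bullet> (G *v (L *v v))"
  proof (rule commuting_nonneg_product[of "(*v) G" "(*v) L"])
    show "G *v (L *v x) = L *v (G *v x)" for x
      using assms(5) by (simp add: matrix_vector_mul_assoc)
    show "(G *v x) \<bullet> y = x \<bullet> (G *v y)" "(L *v x) \<bullet> y = x \<bullet> (L *v y)" for x y
      using inner_matrix_transpose[of G x y] inner_matrix_transpose[of L x y] assms(1,3)
      by simp_all
  qed (use assms in \<open>auto simp: nonneg_definite_def\<close>)
  then have "v \<bullet> v \<le> v \<bullet> (v + c *\<^sub>R (G *v (L *v v)))"
    using assms(6) by (simp add: inner_add_right)
  also have "\<dots> \<le> norm v * norm (v + c *\<^sub>R (G *v (L *v v)))"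
    by (rule norm_cauchy_schwarz)
  finally show ?thesis
    using False by (simp add: power2_eq_square flip: power2_norm_eq_inner)
qed simp

text \<open>The derivative of the residual at \<open>U\<close> in direction \<open>v\<close> is obtained for the vector \<open>w\<close> with
  entries \<open>f' (U $ i) * v $ i\<close>. Only the Lipschitz bound on \<open>w\<close> matters for the estimates, which makes
  them uniform in \<open>U\<close>.\<close>

definition linearized_residual ::
  "real \<Rightarrow> real \<Rightarrow> real \<Rightarrow> real^'s^'s \<Rightarrow> real^'s^'s
    \<Rightarrow> real^('t::{finite,linorder} \<times> 's) \<Rightarrow> real^('t \<times> 's) \<Rightarrow> real^('t \<times> 's)" where
  "linearized_residual a b h G L v w =
     kronecker backward_diff (mat 1) *v v
     + h *\<^sub>R (kronecker (mat 1) G *v (a *\<^sub>R (kronecker (mat 1) L *v v) + b *\<^sub>R w))"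

lemma linearized_residual_lower_bound:
  fixes G L :: "real^'s^'s"
  assumes nonneg: "0 \<le> a" "0 \<le> b" "0 < h" "0 \<le> \<Lambda>"
    and GL: "transpose G = G" "nonneg_definite G" "transpose L = L" "nonneg_definite L"
      "G ** L = L ** G"
    and small: "h * b * onorm ((*v) G) * \<Lambda> < 1"
  shows "\<exists>C\<ge>0. \<forall>v w :: real^('t::{finite,linorder} \<times> 's).
    (\<forall>k. norm (slice w k) \<le> \<Lambda> * norm (slice v k)) \<longrightarrow>
      norm v \<le> C * norm (linearized_residual a b h G L v w)"
proof -
  \<comment> \<open>What remains of the coefficient of \<open>norm (slice v k)\<close> once the
    nonlinear term, of size at most \<open>(1 - \<theta>) * norm (slice v k)\<close>, is
    absorbed.\<close>
  define \<theta> where "\<theta> = 1 - h * b * onorm ((*v) G) * \<Lambda>"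
  have "\<theta> > 0" using small by (simp add: \<theta>_def)
  then obtain C where C: "C \<ge> 0" and gronwall:
    "\<And>(z :: 't \<Rightarrow> real) y. 0 \<le> y \<Longrightarrow> \<forall>k. \<theta> * z k \<le> y + (\<Sum>l\<in>{..<k}. z l)
      \<Longrightarrow> (\<Sum>k\<in>UNIV. z k) \<le> C * y"
    using discrete_gronwall_finite by metis
  have "norm v \<le> C * norm (linearized_residual a b h G L v w)"
    if w: "\<forall>k. norm (slice w k) \<le> \<Lambda> * norm (slice v k)"
    for v w :: "real^('t \<times> 's)"
  proof -
    let ?y = "linearized_residual a b h G L v w"
    have "\<theta> * norm (slice v k) \<le> norm ?y + (\<Sum>l\<in>{..<k}. norm (slice v l))" for k
    proof -
      let ?R = "slice v k - slice (kronecker backward_diff (mat 1) *v v) k"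
      have "norm (slice v k) \<le> norm (slice v k + (h * a) *\<^sub>R (G *v (L *v slice v k)))"
        using nonneg by (intro norm_le_norm_id_plus_product GL) simp
      \<comment> \<open>The slice of the scheme at level \<open>k\<close>, solved for its implicit
        part; \<open>?R\<close> carries the previous level.\<close>
      also have "slice v k + (h * a) *\<^sub>R (G *v (L *v slice v k))
          = slice ?y k + ?R - (h * b) *\<^sub>R (G *v slice w k)"
        by (simp add: linearized_residual_def slice_add slice_scaleR slice_kronecker_id_left
            matrix_vector_right_distrib matrix_vector_mult_scaleR scaleR_add_right)
      also have "norm \<dots> \<le> norm (slice ?y k) + norm ?R + norm ((h * b) *\<^sub>R (G *v slice w k))"
        by (meson add_mono norm_triangle_ineq norm_triangle_ineq4 order_refl order_trans)
      also have "norm (slice ?y k) \<le> norm ?y" by (rule norm_slice_le)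
      also have "norm ?R \<le> (\<Sum>l\<in>{..<k}. norm (slice v l))"
        by (rule norm_backward_diff_remainder)
      also have "norm ((h * b) *\<^sub>R (G *v slice w k)) \<le> (1 - \<theta>) * norm (slice v k)"
      proof -
        have "norm ((h * b) *\<^sub>R (G *v slice w k)) = h * b * norm (G *v slice w k)"
          using nonneg by simp
        also have "\<dots> \<le> h * b * (onorm ((*v) G) * norm (slice w k))"
          using nonneg by (intro mult_left_mono norm_matrix_vector_le) auto
        also have "\<dots> \<le> h * b * (onorm ((*v) G) * (\<Lambda> * norm (slice v k)))"
          using nonneg w by (intro mult_left_mono onorm_pos_le matrix_vector_mul_bounded_linear) auto
        finally show ?thesis by (simp add: \<theta>_def mult_ac)
      qed
      finally show ?thesis by (simp add: algebra_simps)
    qed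
    then have "(\<Sum>k\<in>UNIV. norm (slice v k)) \<le> C * norm ?y"
      by (intro gronwall) auto
    with norm_le_sum_slices[of v] show ?thesis by linarith
  qed
  with C show ?thesis by blast
qed

lemma linearized_residual_upper_bound:
  assumes "0 \<le> \<Lambda>"
  shows "\<exists>C\<ge>0. \<forall>v w :: real^('t::{finite,linorder} \<times> 's::finite).
    norm w \<le> \<Lambda> * norm v \<longrightarrow> norm (linearized_residual a b h G L v w) \<le> C * norm v"
proof -
  let ?D = "kronecker backward_diff (mat 1) :: real^('t \<times> 's)^('t \<times> 's)"
  let ?G = "kronecker (mat 1) G :: real^('t \<times> 's)^('t \<times> 's)"
  let ?L = "kronecker (mat 1) L :: real^('t \<times> 's)^('t \<times> 's)"
  let ?C = "onorm ((*v) ?D) + \<bar>h\<bar> * (onorm ((*v) ?G) * (\<bar>a\<bar> * onorm ((*v) ?L) + \<bar>b\<bar> * \<Lambda>))"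
  have pos: "0 \<le> onorm ((*v) A)" for A :: "real^('t \<times> 's)^('t \<times> 's)"
    by (intro onorm_pos_le matrix_vector_mul_bounded_linear)
  have "norm (linearized_residual a b h G L v w) \<le> ?C * norm v"
    if w: "norm w \<le> \<Lambda> * norm v" for v w :: "real^('t \<times> 's)"
  proof -
    have "norm (linearized_residual a b h G L v w)
        \<le> norm (?D *v v) + \<bar>h\<bar> * norm (?G *v (a *\<^sub>R (?L *v v) + b *\<^sub>R w))"
      unfolding linearized_residual_def by (rule norm_triangle_le) simp
    also have "\<dots> \<le> onorm ((*v) ?D) * norm v
        + \<bar>h\<bar> * (onorm ((*v) ?G) * norm (a *\<^sub>R (?L *v v) + b *\<^sub>R w))"
      by (intro add_mono mult_left_mono norm_matrix_vector_le) auto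
    also have "norm (a *\<^sub>R (?L *v v) + b *\<^sub>R w) \<le> (\<bar>a\<bar> * onorm ((*v) ?L) + \<bar>b\<bar> * \<Lambda>) * norm v"
    proof -
      have "norm (a *\<^sub>R (?L *v v) + b *\<^sub>R w) \<le> \<bar>a\<bar> * norm (?L *v v) + \<bar>b\<bar> * norm w"
        by (rule norm_triangle_le) simp
      also have "\<dots> \<le> \<bar>a\<bar> * (onorm ((*v) ?L) * norm v) + \<bar>b\<bar> * (\<Lambda> * norm v)"
        using w by (intro add_mono mult_left_mono norm_matrix_vector_le) auto
      finally show ?thesis by (simp add: distrib_right mult.assoc)
    qed
    finally show ?thesis using pos by (simp add: mult_left_mono distrib_right mult.assoc)
  qed
  moreover have "0 \<le> ?C" using pos assms by simp
  ultimately show ?thesis by blast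
qed

section \<open>The Jacobian of the preconditioned residual\<close>

lemma lipschitz_derivative_bound:
  fixes f :: "real \<Rightarrow> real"
  assumes lip: "\<Lambda>-lipschitz_on UNIV f" and d: "(f has_real_derivative d) (at x)"
  shows "\<bar>d\<bar> \<le> \<Lambda>"
proof -
  have "((\<lambda>y. \<bar>(f y - f x) / (y - x)\<bar>) \<longlongrightarrow> \<bar>d\<bar>) (at x)"
    using d unfolding has_field_derivative_iff by (rule tendsto_rabs)
  moreover have "\<forall>\<^sub>F y in at x. \<bar>(f y - f x) / (y - x)\<bar> \<le> \<Lambda>"
    unfolding eventually_at_filter
  proof (intro always_eventually allI impI)
    fix y assume "y \<noteq> x"
    have "\<bar>f y - f x\<bar> \<le> \<Lambda> * \<bar>y - x\<bar>"
      using lipschitz_onD[OF lip, of y x] by (simp add: dist_real_def)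
    then show "\<bar>(f y - f x) / (y - x)\<bar> \<le> \<Lambda>"
      using \<open>y \<noteq> x\<close> by (simp add: abs_divide pos_divide_le_eq)
  qed
  ultimately show ?thesis by (rule tendsto_upperbound) simp
qed

lemma has_derivative_entrywise:
  fixes U :: "real^'n"
  assumes "\<And>x. (f has_real_derivative d x) (at x)"
  shows "((\<lambda>U. \<chi> i. f (U $ i)) has_derivative (\<lambda>v. \<chi> i. v $ i * d (U $ i))) (at U)"
proof (rule has_derivative_componentwise_within[THEN iffD2], rule ballI)
  fix e :: "real^'n" assume "e \<in> Basis"
  then obtain i where i: "e = axis i 1" by (auto simp: Basis_vec_def)
  have "((\<lambda>U. f (U $ i)) has_derivative (\<lambda>v. v $ i * d (U $ i))) (at U)"
    by (intro DERIV_compose_FDERIV assms bounded_linear_imp_has_derivative bounded_linear_vec_nth)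
  then show "((\<lambda>U. (\<chi> i. f (U $ i)) \<bullet> e) has_derivative (\<lambda>v. (\<chi> i. v $ i * d (U $ i)) \<bullet> e)) (at U)"
    by (simp add: i inner_axis)
qed

lemma jacobian_preconditioned_residual:
  assumes "\<And>x. (f has_real_derivative d x) (at x)"
  shows "preconditioned_residual a b h f G L J V differentiable (at U)" (is ?diff)
    and "jacobian (preconditioned_residual a b h f G L J V) (at U) *v v
      = matrix_inv (preconditioner a b h G L J)
          *v linearized_residual a b h G L v (\<chi> i. v $ i * d (U $ i))" (is ?jac)
proof -
  have matrix: "((\<lambda>U. A *v g U) has_derivative (\<lambda>v. A *v g' v)) (at U)"
    if "(g has_derivative g') (at U)" for A and g g' :: "real^'n \<Rightarrow> real^'m" and U
    by (rule bounded_linear.has_derivative[OF matrix_vector_mul_bounded_linear that])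
  have der: "(preconditioned_residual a b h f G L J V has_derivative
      (\<lambda>v. matrix_inv (preconditioner a b h G L J)
          *v linearized_residual a b h G L v (\<chi> i. v $ i * d (U $ i)))) (at U)"
    unfolding preconditioned_residual_def[abs_def] scheme_residual_def linearized_residual_def
    by (rule matrix) (auto intro!: derivative_eq_intros matrix has_derivative_entrywise assms)
  then show diff: ?diff by (rule differentiableI)
  show ?jac
    using has_derivative_unique[OF diff[unfolded jacobian_works] der] by (rule fun_cong)
qed

lemma invertible_mult_matrix_inv:
  fixes M :: "'a::semiring_1^'n^'m"
  assumes "invertible M"
  shows "M ** matrix_inv M = mat 1"
  using someI_ex[OF assms[unfolded invertible_def]] by (simp add: matrix_inv_def)

text \<open>Multiplying by the preconditioner recovers the linearized residual from the Jacobian.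
  Hence its lower bound survives up to the norm of the preconditioner, and its upper bound up to the
  norm of the inverse.\<close>

lemma jacobian_preconditioned_residual_bounds:
  fixes G L J :: "real^'s^'s" and V :: "real^('t::{finite,linorder} \<times> 's)"
  assumes nonneg: "0 \<le> a" "0 \<le> b" "0 < h"
    and f: "\<And>x. (f has_real_derivative d x) (at x)" "\<Lambda>-lipschitz_on UNIV f"
    and GL: "transpose G = G" "nonneg_definite G" "transpose L = L" "nonneg_definite L"
      "G ** L = L ** G"
    and small: "h * b * onorm ((*v) G) * \<Lambda> < 1"
    and inv: "invertible (preconditioner a b h G L J :: real^('t \<times> 's)^('t \<times> 's))"
  obtains s S where "0 < s"
    "\<And>U v. s * norm v \<le> norm (jacobian (preconditioned_residual a b h f G L J V) (at U) *v v)"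
    "\<And>U v. norm (jacobian (preconditioned_residual a b h f G L J V) (at U) *v v) \<le> S * norm v"
proof -
  let ?M = "preconditioner a b h G L J :: real^('t \<times> 's)^('t \<times> 's)"
  let ?W = "\<lambda>U v. (\<chi> i. v $ i * d (U $ i)) :: real^('t \<times> 's)"
  let ?J = "\<lambda>U. jacobian (preconditioned_residual a b h f G L J V) (at U)"
  have \<Lambda>: "0 \<le> \<Lambda>" using f(2) by (rule lipschitz_on_nonneg)
  have entry: "norm (x * d y) \<le> norm (\<Lambda> * x)" for x y
    using mult_right_mono[OF lipschitz_derivative_bound[OF f(2) f(1)], of "\<bar>x\<bar>" y] \<Lambda>
    by (simp add: abs_mult mult.commute)
  \<comment> \<open>The lower bound needs the Lipschitz estimate on every time level separately; for
    the upper bound the whole-vector version \<open>norm_W\<close> is enough.\<close>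
  have slice_W: "\<forall>k. norm (slice (?W U v) k) \<le> \<Lambda> * norm (slice v k)" for U v
  proof
    fix k
    have "norm (slice (?W U v) k) \<le> norm (\<Lambda> *\<^sub>R slice v k)"
      by (rule norm_le_componentwise_cart) (simp add: entry del: real_norm_def)
    then show "norm (slice (?W U v) k) \<le> \<Lambda> * norm (slice v k)" using \<Lambda> by simp
  qed
  have norm_W: "norm (?W U v) \<le> \<Lambda> * norm v" for U v
  proof -
    have "norm (?W U v) \<le> norm (\<Lambda> *\<^sub>R v)"
      by (rule norm_le_componentwise_cart) (simp add: entry del: real_norm_def)
    then show ?thesis using \<Lambda> by simp
  qed
  obtain C where C: "C \<ge> 0" "\<And>U v. norm v \<le> C * norm (linearized_residual a b h G L v (?W U v))"
    using linearized_residual_lower_bound[OF nonneg \<Lambda> GL small] slice_W by metis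
  obtain D where D: "D \<ge> 0" "\<And>U v. norm (linearized_residual a b h G L v (?W U v)) \<le> D * norm v"
    using linearized_residual_upper_bound[OF \<Lambda>] norm_W by metis
  \<comment> \<open>Both increments by 1 keep \<open>m\<close> positive even if \<open>C\<close> or
    the norm vanishes, so that \<open>1 / m\<close> is a valid lower constant.\<close>
  define m where "m = (C + 1) * (onorm ((*v) ?M) + 1)"
  have onorm_M: "0 \<le> onorm ((*v) ?M)"
    by (intro onorm_pos_le matrix_vector_mul_bounded_linear)
  have m: "0 < m" using C(1) onorm_M by (simp add: m_def)
  have J_eq: "?J U *v v = matrix_inv ?M *v linearized_residual a b h G L v (?W U v)" for U v
    by (rule jacobian_preconditioned_residual[OF f(1)])
  have "1 / m * norm v \<le> norm (?J U *v v)" for U v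
  proof -
    let ?r = "linearized_residual a b h G L v (?W U v)"
    have "?r = ?M *v (?J U *v v)"
      by (simp add: J_eq matrix_vector_mul_assoc invertible_mult_matrix_inv[OF inv])
    then have "norm ?r = norm (?M *v (?J U *v v))" by (rule arg_cong)
    also have "\<dots> \<le> onorm ((*v) ?M) * norm (?J U *v v)" by (rule norm_matrix_vector_le)
    also have "\<dots> \<le> (onorm ((*v) ?M) + 1) * norm (?J U *v v)"
      by (intro mult_right_mono) auto
    finally have "(C + 1) * norm ?r \<le> m * norm (?J U *v v)"
      using C(1) by (simp add: m_def mult.assoc)
    moreover have "norm v \<le> (C + 1) * norm ?r"
      using C(2)[of v U] by (simp add: distrib_right add_increasing2)
    ultimately show ?thesis using m by (simp add: field_simps)
  qed
  moreover have "norm (?J U *v v) \<le> onorm ((*v) (matrix_inv ?M)) * D * norm v" for U v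
  proof -
    have "norm (?J U *v v)
        \<le> onorm ((*v) (matrix_inv ?M)) * norm (linearized_residual a b h G L v (?W U v))"
      unfolding J_eq by (rule norm_matrix_vector_le)
    also have "\<dots> \<le> onorm ((*v) (matrix_inv ?M)) * (D * norm v)"
      by (intro mult_left_mono D onorm_pos_le matrix_vector_mul_bounded_linear)
    finally show ?thesis by (simp add: mult.assoc)
  qed
  ultimately show thesis using m by (intro that[of "1 / m"]) auto
qed

text \<open>The \<open>bdd_above\<close> conjunct expresses that the supremum is finite, since a
  real \<open>SUP\<close> over an unbounded range would only be a default value.\<close>

theorem theorem5:
  fixes G L J :: "real^('x::finite \<times> 'x)^('x \<times> 'x)"
    and V :: "real^('t::{finite,linorder} \<times> ('x \<times> 'x))"
    and M :: "real^('t \<times> ('x \<times> 'x))^('t \<times> ('x \<times> 'x))"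
    and Fhat :: "real^('t \<times> ('x \<times> 'x)) \<Rightarrow> real^('t \<times> ('x \<times> 'x))"
    and f :: "real \<Rightarrow> real"
    and a b h Lip \<sigma>_lo \<sigma>_hi \<kappa> :: real
  assumes "a \<ge> 0" and "b \<ge> 0"
    and "f C1_differentiable_on UNIV" and "Lip-lipschitz_on UNIV f"
    and "transpose G = G" and "nonneg_definite G"
    and "transpose L = L" and "nonneg_definite L"
    and "G ** L = L ** G"
    and "h > 0" and "h * \<bar>b\<bar> * onorm ((*v) G) * Lip < 1"
    and "M = preconditioner a b h G L J" and "invertible M"
    and "Fhat = preconditioned_residual a b h f G L J V"
    and "\<sigma>_lo = (INF U. sigma_min (jacobian Fhat (at U)))"
    and "\<sigma>_hi = (SUP U. sigma_max (jacobian Fhat (at U)))"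
    and "\<kappa> = \<sigma>_hi / \<sigma>_lo"
  shows "0 < \<sigma>_lo \<and> \<sigma>_lo \<le> \<sigma>_hi
    \<and> bdd_above (range (\<lambda>U. sigma_max (jacobian Fhat (at U))))
    \<and> (\<forall>\<delta> \<gamma> \<epsilon> U Q.
         \<bar>\<delta>\<bar> < 1 / \<kappa> \<longrightarrow> \<gamma> = (1 - \<delta>) / \<kappa> \<longrightarrow> \<epsilon> = (1 - \<delta>) * \<kappa> \<longrightarrow> pdhg_flow Fhat \<gamma> \<epsilon> U Q \<longrightarrow>
         (\<exists>C\<ge>0. \<exists>r>0. \<forall>t\<ge>0. norm (Fhat (U t)) \<le> C * exp (- r * t)))"
proof -
  obtain d where d: "\<And>x. (f has_real_derivative d x) (at x)"
    using assms(3) unfolding C1_differentiable_on_def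
    by (auto simp: has_real_derivative_iff_has_vector_derivative)
  have small: "h * b * onorm ((*v) G) * Lip < 1" using assms(2,11) by simp
  have inv: "invertible (preconditioner a b h G L J :: real^('t \<times> ('x \<times> 'x))^('t \<times> ('x \<times> 'x)))"
    using assms(12,13) by simp
  let ?J = "\<lambda>U. jacobian Fhat (at U)"
  obtain s S where s: "0 < s"
    and lo: "\<And>U v. s * norm v \<le> norm (?J U *v v)"
    and hi: "\<And>U v. norm (?J U *v v) \<le> S * norm v"
    unfolding assms(14)
    using jacobian_preconditioned_residual_bounds[OF assms(1,2,10) d assms(4-9) small inv] by metis
  have min_ge: "s \<le> sigma_min (?J U)" for U
    by (intro sigma_min_ge lo)
  then have bdd_min: "bdd_below (range (\<lambda>U. sigma_min (?J U)))" by (rule bdd_belowI2)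
  have bdd_max: "bdd_above (range (\<lambda>U. sigma_max (?J U)))"
    by (rule bdd_aboveI2[where M = S]) (intro sigma_max_le hi)
  have lo_le: "\<sigma>_lo \<le> sigma_min (?J U)" and hi_ge: "sigma_max (?J U) \<le> \<sigma>_hi" for U
    unfolding assms(15,16) by (auto intro: cINF_lower cSUP_upper bdd_min bdd_max)
  \<comment> \<open>Because \<open>s\<close> does not depend on \<open>U\<close>, it survives the
    infimum; positivity at each single \<open>U\<close> would not suffice.\<close>
  have "s \<le> \<sigma>_lo" unfolding assms(15) by (intro cINF_greatest min_ge) auto
  then have pos: "0 < \<sigma>_lo" using s by simp
  have le: "\<sigma>_lo \<le> \<sigma>_hi"
    using lo_le[of 0] hi_ge[of 0] sigma_min_le_sigma_max[of "?J 0"] by linarith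
  have "\<exists>C\<ge>0. \<exists>r>0. \<forall>t\<ge>0. norm (Fhat (U t)) \<le> C * exp (- r * t)"
    if "\<bar>\<delta>\<bar> < 1 / \<kappa>" "\<gamma> = (1 - \<delta>) / \<kappa>" "\<epsilon> = (1 - \<delta>) * \<kappa>" "pdhg_flow Fhat \<gamma> \<epsilon> U Q"
    for \<delta> \<gamma> \<epsilon> U Q
  proof (rule pdhg_flow_exponential_convergence[OF _ _ _ pos le assms(17) that])
    show "Fhat differentiable (at x)" for x
      unfolding assms(14) by (rule jacobian_preconditioned_residual[OF d])
    show "\<sigma>_lo * norm v \<le> norm (?J x *v v)" for x v
      using sigma_min_le_norm[of "?J x" v] mult_right_mono[OF lo_le[of x], of "norm v"] by simp
    show "norm (?J x *v v) \<le> \<sigma>_hi * norm v" for x v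
      using norm_le_sigma_max[of "?J x" v] mult_right_mono[OF hi_ge[of x], of "norm v"] by simp
  qed
  with pos le bdd_max show ?thesis by blast
qed

end
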